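(* Let $m=1$, let $0<\epsilon<1$, $0<\beta<1$, and let $N^*(1)=\left\lceil\frac1\epsilon\frac{e}{e-1}\left(1+\ln\frac1\beta\right)\right\rceil$. Let $\boldsymbol s_1,\dots,\boldsymbol s_N$ be $N$ independent scenarios drawn from the distribution of a real-valued random variable $\boldsymbol s$, with $\mathcal S=\hat{\boldsymbol s}=\{\boldsymbol s_1,\dots,\boldsymbol s_N\}$, and let $\mathcal U_{\mathrm{PCA}}(\mathcal S,m)$ be the scenario-induced uncertainty set defined in the context. If $$N\ \ge\ \frac{\ln\beta-\ln\left(1-\epsilon+N^*(1)\,\epsilon\right)}{\ln(1-\epsilon)}+1,$$ then with confidence at least $1-\beta$ any realization $\boldsymbol s$ belongs to $\mathcal U_{\mathrm{PCA}}(\mathcal S,m)$ with probability at least $1-\epsilon$, i.e. $$\mathbb P_{\hat{\boldsymbol s}}\left\{\mathbb P_{\boldsymbol s}\{\boldsymbol s\in\mathcal U_{\mathrm{PCA}}(\mathcal S,m)\}\ge 1-\epsilon\right\}\ge 1-\beta.$$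
   Context: No assumption is made on the probability distribution of the uncertain data. $\mathbb P_{\hat{\boldsymbol s}}$ is the probability over the random draw of the $N$ scenarios, and $\mathbb P_{\boldsymbol s}$ is the probability over a fresh realization $\boldsymbol s$ from the same distribution, independent of the scenarios (which are held fixed in the inner probability). $\lceil x\rceil$ is the smallest integer not smaller than $x$, and $e$ is Euler's number. Definition of the uncertainty set for scenarios in $\mathbb R^m$ (here $m=1$), using all $m$ principal components: let $\bar{\boldsymbol s}=\frac1N\sum_{j=1}^N\boldsymbol s_j$, $\boldsymbol s_{j0}=\boldsymbol s_j-\bar{\boldsymbol s}$, let $\boldsymbol X_0\in\mathbb R^{N\times m}$ have rows $\boldsymbol s_{j0}^\top$, and let $\boldsymbol C=\frac1{N-1}\boldsymbol X_0^\top\boldsymbol X_0=\boldsymbol U\boldsymbol\Lambda\boldsymbol U^\top$ be the eigenvalue decomposition of the sample covariance matrix, with $\boldsymbol U$ orthogonal and the eigenvalues in non-increasing order; the principal directions $\boldsymbol d_1,\dots,\boldsymbol d_m$ are the columns of $\boldsymbol U$. With $\overline\omega_i=\max_{j=1,\dots,N}\frac{\boldsymbol s_{j0}\cdot\boldsymbol d_i}{\|\boldsymbol d_i\|}$ and $\underline\omega_i=\min_{j=1,\dots,N}\frac{\boldsymbol s_{j0}\cdot\boldsymbol d_i}{\|\boldsymbol d_i\|}$, $$\mathcal U_{\mathrm{PCA}}(\mathcal S,m)=\Big\{\boldsymbol u:\ \boldsymbol u=\bar{\boldsymbol s}+\sum_{i=1}^{m}\Big(\alpha_i\frac{\overline\omega_i}{\|\boldsymbol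 d_i\|}\boldsymbol d_i+(1-\alpha_i)\frac{\underline\omega_i}{\|\boldsymbol d_i\|}\boldsymbol d_i\Big),\ 0\le\alpha_i\le1\ \ \forall i\in\{1,\dots,m\}\Big\}.$$ *)

theory Defs
  imports "HOL-Probability.Probability"
begin

text \<open>
  A sample of \<open>N\<close> scenarios in \<open>\<real>\<^sup>m\<close> is a family \<open>s 1, \<dots>, s N\<close> (repetitions are allowed and count
  with multiplicity in the mean); only its values on \<open>{1..N}\<close> are ever used.  The dimension \<open>m\<close>
  is \<open>CARD('m)\<close>, and the linear order on \<open>'m\<close> gives a meaning to ``non-increasing order'' of the
  eigenvalues.
\<close>

definition sample_mean :: "nat \<Rightarrow> (nat \<Rightarrow> real^'m) \<Rightarrow> real^'m" where
  "sample_mean N s = (1 / real N) *\<^sub>R (\<Sum>j=1..N. s j)"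

definition centred :: "nat \<Rightarrow> (nat \<Rightarrow> real^'m) \<Rightarrow> nat \<Rightarrow> real^'m" where
  "centred N s j = s j - sample_mean N s"

text \<open>
  Entrywise form of \<open>X\<^sub>0\<^sup>T X\<^sub>0 / (N - 1)\<close>, where the \<open>j\<close>-th row of the \<open>N \<times> m\<close> matrix \<open>X\<^sub>0\<close> is
  \<open>centred N s j\<close>.
\<close>

definition sample_cov :: "nat \<Rightarrow> (nat \<Rightarrow> real^'m) \<Rightarrow> real^'m^'m" where
  "sample_cov N s =
     (1 / (real N - 1)) *\<^sub>R (\<chi> k l. \<Sum>j=1..N. centred N s j $ k * centred N s j $ l)"

definition eigen_decomposition ::
    "real^('m::{finite,linorder})^('m::{finite,linorder}) \<Rightarrow> real^('m::{finite,linorder})^('m::{finite,linorder})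
      \<Rightarrow> real^('m::{finite,linorder}) \<Rightarrow> bool" where
  "eigen_decomposition C U evs \<longleftrightarrow>
     orthogonal_matrix U \<and>
     C = U ** (\<chi> i j. if i = j then evs $ i else 0) ** transpose U \<and>
     (\<forall>i j. i \<le> j \<longrightarrow> evs $ j \<le> evs $ i)"

definition omega_max :: "nat \<Rightarrow> (nat \<Rightarrow> real^'m) \<Rightarrow> real^'m \<Rightarrow> real" where
  "omega_max N s d = Max ((\<lambda>j. (centred N s j \<bullet> d) / norm d) ` {1..N})"

definition omega_min :: "nat \<Rightarrow> (nat \<Rightarrow> real^'m) \<Rightarrow> real^'m \<Rightarrow> real" where
  "omega_min N s d = Min ((\<lambda>j. (centred N s j \<bullet> d) / norm d) ` {1..N})"

text \<open>
  An eigenvalue decomposition is not unique (already for \<open>m = 1\<close> the direction may be \<open>1\<close> or \<open>-1\<close>),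
  so the matrix \<open>U\<close>, whose columns are the principal directions, is an explicit argument.
\<close>

definition U_PCA :: "nat \<Rightarrow> (nat \<Rightarrow> real^'m) \<Rightarrow> real^'m^'m \<Rightarrow> (real^'m) set" where
  "U_PCA N s U =
     {sample_mean N s +
        (\<Sum>i\<in>UNIV. (\<alpha> i * (omega_max N s (column i U) / norm (column i U))) *\<^sub>R column i U
          + ((1 - \<alpha> i) * (omega_min N s (column i U) / norm (column i U))) *\<^sub>R column i U)
      | \<alpha>. \<forall>i. 0 \<le> \<alpha> i \<and> \<alpha> i \<le> (1::real)}"

end

theory Submission
  imports Defs
begin

text \<open>
  In dimension one the principal direction is \<open>1\<close> or \<open>-1\<close>, and in both cases the uncertainty set is
  the interval from the least to the greatest scenario (\<open>vec_mem_U_PCA_iff\<close>).  The theorem is therefore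
  about the probability mass that the range of \<open>n\<close> independent draws from a distribution \<open>D\<close> on the
  line covers.

  For the uniform distribution on \<open>(0, 1)\<close> the range is shorter than \<open>c\<close> with probability exactly
  \<open>c ^ (n - 1) * (c + n * (1 - c))\<close>: if the least draw is \<open>y\<close>, the others have to fall into
  \<open>[y, y + c)\<close>, which has mass \<open>min c (1 - y)\<close>, so one integrates \<open>n * (min c (1 - y)) ^ (n - 1)\<close>
  over \<open>y\<close>.  Only the upper bound matters, and it follows from a union bound over the index of the
  least draw (\<open>emeasure_uniform_range_less\<close>).  An arbitrary \<open>D\<close>, with atoms or without, is the image of
  the uniform distribution under its quantile function.  That function is monotone, so the range of the
  transformed draws has \<open>D\<close>-mass at least the length of the range of the uniform draws, and the
  bound carries over (\<open>prob_hull_mass_less\<close>).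

  With \<open>c = 1 - \<epsilon>\<close> it remains to see that \<open>(1 - \<epsilon>) ^ (N - 1) * (1 - \<epsilon> + N * \<epsilon>) \<le> \<beta>\<close>.  The assumption
  on \<open>N\<close> is this inequality with \<open>N*\<close> in place of the second \<open>N\<close>, which suffices for \<open>N \<le> N*\<close>.  For
  \<open>N \<ge> N*\<close> it follows from a Chernoff-type estimate (\<open>range_tail_le_exp\<close>): without the rounding, \<open>N*\<close>
  is the sample size at which that estimate equals \<open>\<beta>\<close>.
\<close>

section \<open>The tail function\<close>

text \<open>
  The left-hand side is the probability of at most one success in \<open>n\<close> trials with success probability
  \<open>\<epsilon>\<close>; the bound is Chernoff's, with the exponential parameter \<open>1\<close>.  The first two terms in
  the binomial expansion of \<open>e * (1 - \<epsilon> + \<epsilon> / e) ^ n\<close>, which Bernoulli's inequality extracts, already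
  dominate the left-hand side.
\<close>

lemma range_tail_le_exp:
  fixes \<epsilon> :: real
  assumes "0 < \<epsilon>" "\<epsilon> < 1" "0 < n"
  shows "(1 - \<epsilon>) ^ (n - 1) * (1 - \<epsilon> + real n * \<epsilon>) \<le> exp (1 - real n * \<epsilon> * (1 - exp (-1)))"
proof -
  define c where "c = 1 - \<epsilon>"
  define t where "t = \<epsilon> * exp (-1)"
  have c: "0 < c" and t: "0 < t"
    using assms by (simp_all add: c_def t_def)
  have cn: "c ^ n = c ^ (n - 1) * c"
    using \<open>0 < n\<close> by (simp add: power_eq_if)
  have "c ^ (n - 1) * (c + real n * \<epsilon>) = c ^ n + real n * \<epsilon> * c ^ (n - 1)"
    by (simp add: cn algebra_simps)
  also have "\<dots> \<le> exp 1 * c ^ n + real n * \<epsilon> * c ^ (n - 1)"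
    using c by simp
  also have "\<dots> = exp 1 * (c ^ n * (1 + real n * (t / c)))"
    using c by (simp add: cn t_def field_simps flip: exp_add)
  also have "\<dots> \<le> exp 1 * (c ^ n * (1 + t / c) ^ n)"
    using c t by (intro mult_left_mono Bernoulli_inequality) (auto intro: order_trans[of _ 0])
  also have "\<dots> = exp 1 * (c + t) ^ n"
    using c by (simp add: field_simps flip: power_mult_distrib)
  also have "\<dots> \<le> exp 1 * exp (- \<epsilon> * (1 - exp (-1))) ^ n"
    using c t exp_ge_add_one_self[of "- \<epsilon> * (1 - exp (-1))"]
    by (intro mult_left_mono power_mono) (auto simp: c_def t_def algebra_simps)
  also have "\<dots> = exp (1 - real n * \<epsilon> * (1 - exp (-1)))"
    by (simp add: algebra_simps flip: exp_add exp_of_nat_mult)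
  finally show ?thesis
    by (simp add: c_def)
qed

text \<open>
  Both \<open>e / (e - 1)\<close> and \<open>1 + ln (1 / \<beta>)\<close> exceed \<open>1\<close>, hence \<open>K * \<epsilon> > 1\<close>.  The quotient in the assumption
  is then positive, and \<open>n\<close> cannot be \<open>0\<close>.  The inequality itself comes from the assumption on \<open>n\<close> when
  \<open>n \<le> K\<close>, and from the exponential bound, which decreases in \<open>n\<close>, when \<open>n > K\<close>.
\<close>

lemma range_tail_le_of_sample_size:
  fixes \<epsilon> \<beta> :: real
  assumes eps: "0 < \<epsilon>" "\<epsilon> < 1" and beta: "0 < \<beta>" "\<beta> < 1"
    and K: "K = \<lceil>1 / \<epsilon> * (exp 1 / (exp 1 - 1)) * (1 + ln (1 / \<beta>))\<rceil>"
    and n: "real n \<ge> (ln \<beta> - ln (1 - \<epsilon> + real_of_int K * \<epsilon>)) / ln (1 - \<epsilon>) + 1"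
  shows "0 < n" "(1 - \<epsilon>) ^ (n - 1) * (1 - \<epsilon> + real n * \<epsilon>) \<le> \<beta>"
proof -
  have L: "ln (1 / \<beta>) > 0" "ln (1 / \<beta>) = - ln \<beta>"
    using beta by (simp_all add: ln_div)
  have e: "exp (1::real) > 1"
    by simp
  have q: "exp 1 / (exp 1 - 1) > (1::real)"
    using e by (simp add: field_simps)
  define a where "a = exp 1 / (exp 1 - 1) * (1 + ln (1 / \<beta>))"
  have "1 < a"
    unfolding a_def using q L by (intro less_1_mult) auto
  have K': "a \<le> real_of_int K * \<epsilon>"
  proof -
    have "a / \<epsilon> \<le> real_of_int K"
      unfolding K a_def using le_of_int_ceiling[of "1 / \<epsilon> * (exp 1 / (exp 1 - 1)) * (1 + ln (1 / \<beta>))"]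
      by (simp add: mult.commute)
    then show ?thesis
      using eps by (simp add: pos_divide_le_eq)
  qed
  then have B: "1 - \<epsilon> + real_of_int K * \<epsilon> > 1"
    using \<open>1 < a\<close> eps by linarith
  have l: "ln (1 - \<epsilon>) < 0"
    using eps by simp
  have "(ln \<beta> - ln (1 - \<epsilon> + real_of_int K * \<epsilon>)) / ln (1 - \<epsilon>) > 0"
    using B L l by (intro divide_neg_neg) (smt (verit) ln_gt_zero)+
  then show "0 < n"
    using n by linarith
  then have n1: "real (n - 1) = real n - 1"
    by (simp add: of_nat_diff)
  show "(1 - \<epsilon>) ^ (n - 1) * (1 - \<epsilon> + real n * \<epsilon>) \<le> \<beta>"
  proof (cases "int n \<le> K")
    case True
    have "real (n - 1) * ln (1 - \<epsilon>) \<le> ln \<beta> - ln (1 - \<epsilon> + real_of_int K * \<epsilon>)"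
      using n l unfolding n1 by (simp add: field_simps)
    then have "exp (real (n - 1) * ln (1 - \<epsilon>) + ln (1 - \<epsilon> + real_of_int K * \<epsilon>)) \<le> exp (ln \<beta>)"
      by simp
    then have "(1 - \<epsilon>) ^ (n - 1) * (1 - \<epsilon> + real_of_int K * \<epsilon>) \<le> \<beta>"
      using eps beta B by (simp add: exp_add exp_of_nat_mult)
    moreover have "(1 - \<epsilon>) ^ (n - 1) * (1 - \<epsilon> + real n * \<epsilon>)
        \<le> (1 - \<epsilon>) ^ (n - 1) * (1 - \<epsilon> + real_of_int K * \<epsilon>)"
      using True eps by (intro mult_left_mono add_left_mono mult_right_mono) auto
    ultimately show ?thesis
      by linarith
  next
    case False
    then have "real_of_int K * \<epsilon> \<le> real n * \<epsilon>"
      using eps by (intro mult_right_mono) auto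
    with K' have "a * (1 - exp (-1)) \<le> real n * \<epsilon> * (1 - exp (-1))"
      by (intro mult_right_mono) auto
    moreover have "a * (1 - exp (-1)) = 1 + ln (1 / \<beta>)"
      using e by (simp add: a_def exp_minus field_simps)
    ultimately have "exp (1 - real n * \<epsilon> * (1 - exp (-1))) \<le> exp (ln \<beta>)"
      using L by simp
    then show ?thesis
      using range_tail_le_exp[OF eps \<open>0 < n\<close>] beta by simp
  qed
qed

section \<open>The range of a uniform sample\<close>

abbreviation unif :: "real measure" where
  "unif \<equiv> restrict_space lborel {0<..<1}"

lemma prob_space_unif: "prob_space unif"
  by (auto simp: emeasure_restrict_space space_restrict_space intro!: prob_spaceI)

lemma measurable_unif_ident [measurable]: "(\<lambda>x. x) \<in> borel_measurable unif"
  by (rule measurable_restrict_space1) simp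

lemma measurable_unif_coordinate: "i \<in> I \<Longrightarrow> (\<lambda>v. v i) \<in> borel_measurable (PiM I (\<lambda>_. unif))"
  using measurable_compose[OF measurable_component_singleton[of i I "\<lambda>_. unif"] measurable_unif_ident]
  by simp

text \<open>
  The window \<open>[y, y + c)\<close> is cut off at \<open>1\<close> as soon as \<open>y > 1 - c\<close>, so the integral is split there: the
  integrand is constantly \<open>c ^ k\<close> below and \<open>(1 - y) ^ k\<close> above.
\<close>

lemma nn_integral_window_power:
  fixes c :: real
  assumes c: "0 \<le> c" "c \<le> 1"
  shows "(\<integral>\<^sup>+y. ennreal (min c (1 - y)) ^ k \<partial>unif)
     \<le> ennreal ((1 - c) * c ^ k + c ^ Suc k / real (Suc k))"
proof -
  have "(\<integral>\<^sup>+y. ennreal (min c (1 - y)) ^ k \<partial>unif)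
      = (\<integral>\<^sup>+y. ennreal (min c (1 - y)) ^ k * indicator {0<..<1} y \<partial>lborel)"
    by (rule nn_integral_restrict_space) simp
  also have "\<dots> \<le> (\<integral>\<^sup>+y. ennreal (c ^ k) * indicator {0..1 - c} y
      + ennreal ((1 - y) ^ k) * indicator {1 - c..1} y \<partial>lborel)"
    using c by (intro nn_integral_mono)
      (auto simp: indicator_def ennreal_power intro!: ennreal_leI power_mono)
  also have "\<dots> = (\<integral>\<^sup>+y. ennreal (c ^ k) * indicator {0..1 - c} y \<partial>lborel)
      + (\<integral>\<^sup>+y. ennreal ((1 - y) ^ k) * indicator {1 - c..1} y \<partial>lborel)"
    by (rule nn_integral_add) auto
  also have "(\<integral>\<^sup>+y. ennreal (c ^ k) * indicator {0..1 - c} y \<partial>lborel) = ennreal (c ^ k) * ennreal (1 - c)"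
    using c by (subst nn_integral_cmult_indicator) auto
  also have "(\<integral>\<^sup>+y. ennreal ((1 - y) ^ k) * indicator {1 - c..1} y \<partial>lborel)
      = ennreal (- ((1 - 1) ^ Suc k / real (Suc k)) - - ((1 - (1 - c)) ^ Suc k / real (Suc k)))"
  proof (rule nn_integral_FTC_Icc)
    show "((\<lambda>y. - ((1 - y) ^ Suc k / real (Suc k))) has_real_derivative (1 - y) ^ k)
        (at y)" for y
      by (rule derivative_eq_intros refl | simp del: of_nat_Suc)+
  qed (use c in auto)
  finally show ?thesis
    using c by (simp add: mult.commute flip: ennreal_mult ennreal_plus)
qed

text \<open>
  The event that draw \<open>j\<close> is the least one and all others lie in the window of length \<open>c\<close> above it.
  Conditionally on the value \<open>y\<close> of draw \<open>j\<close>, the other draws are independent and each falls into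
  \<open>[y, y + c)\<close> with probability \<open>min c (1 - y)\<close>.
\<close>

lemma emeasure_uniform_window:
  fixes c :: real
  assumes I: "finite I" "j \<in> I" and c: "0 < c" "c < 1"
  shows "{v \<in> space (PiM I (\<lambda>_. unif)). \<forall>i\<in>I. v j \<le> v i \<and> v i < v j + c} \<in> sets (PiM I (\<lambda>_. unif))"
    (is "?E \<in> _")
    and "emeasure (PiM I (\<lambda>_. unif)) {v \<in> space (PiM I (\<lambda>_. unif)). \<forall>i\<in>I. v j \<le> v i \<and> v i < v j + c}
      \<le> ennreal ((1 - c) * c ^ (card I - 1) + c ^ card I / real (card I))"
proof -
  interpret unif: prob_space unif
    by (rule prob_space_unif)
  interpret product_sigma_finite "\<lambda>_. unif"
    by standard
  show E: "?E \<in> sets (PiM I (\<lambda>_. unif))"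
    using I measurable_unif_coordinate
    by (intro sets.sets_Collect_finite_All' sets.sets_Collect_conj borel_measurable_le
        borel_measurable_less borel_measurable_add borel_measurable_const) auto
  let ?J = "I - {j}"
  have J: "finite ?J" "j \<notin> ?J" "insert j ?J = I" "card ?J = card I - 1"
    using I by auto
  have "emeasure (PiM I (\<lambda>_. unif)) ?E = (\<integral>\<^sup>+v. indicator ?E v \<partial>PiM (insert j ?J) (\<lambda>_. unif))"
    unfolding J(3) using E by (rule nn_integral_indicator[symmetric])
  also have "\<dots> = (\<integral>\<^sup>+y. (\<integral>\<^sup>+x. indicator ?E (x(j := y)) \<partial>PiM ?J (\<lambda>_. unif)) \<partial>unif)"
    using J E by (intro product_nn_integral_insert_rev) auto
  also have "\<dots> \<le> (\<integral>\<^sup>+y. ennreal (min c (1 - y)) ^ card ?J \<partial>unif)"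
  proof (rule nn_integral_mono)
    fix y assume "y \<in> space unif"
    then have y: "0 < y" "y < 1"
      by (auto simp: space_restrict_space)
    have "(\<integral>\<^sup>+x. indicator ?E (x(j := y)) \<partial>PiM ?J (\<lambda>_. unif))
        \<le> (\<integral>\<^sup>+x. (\<Prod>i\<in>?J. indicator {y..<y + c} (x i)) \<partial>PiM ?J (\<lambda>_. unif))"
    proof (rule nn_integral_mono)
      fix x
      show "indicator ?E (x(j := y)) \<le> (\<Prod>i\<in>?J. indicator {y..<y + c} (x i) :: ennreal)"
      proof (cases "x(j := y) \<in> ?E")
        case True
        then have "(\<Prod>i\<in>?J. indicator {y..<y + c} (x i) :: ennreal) = 1"
          by (intro prod.neutral) (auto simp: indicator_def split: if_splits)
        then show ?thesis
          by (simp add: indicator_def)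
      qed simp
    qed
    also have "\<dots> = (\<Prod>i\<in>?J. \<integral>\<^sup>+x. indicator {y..<y + c} x \<partial>unif)"
      using J by (intro product_nn_integral_prod) auto
    also have "(\<integral>\<^sup>+x. indicator {y..<y + c} x \<partial>unif)
        = emeasure lborel ({y..<y + c} \<inter> {0<..<1})"
      by (subst nn_integral_restrict_space) (simp_all flip: indicator_inter_arith)
    also have "{y..<y + c} \<inter> {0<..<1} = {y..<min (y + c) 1}"
      using y by auto
    also have "emeasure lborel {y..<min (y + c) 1} = ennreal (min c (1 - y))"
      using y c by (subst emeasure_lborel_Ico) (auto simp: min_def)
    finally show "(\<integral>\<^sup>+x. indicator ?E (x(j := y)) \<partial>PiM ?J (\<lambda>_. unif)) \<le> ennreal (min c (1 - y)) ^ card ?J"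
      by (simp only: prod_constant)
  qed
  also have "\<dots> \<le> ennreal ((1 - c) * c ^ card ?J + c ^ Suc (card ?J) / real (Suc (card ?J)))"
    using c by (intro nn_integral_window_power) auto
  also have "Suc (card ?J) = card I"
    using I by (simp add: card_gt_0_iff J(4)) (metis Suc_pred card_gt_0_iff empty_iff)
  finally show "emeasure (PiM I (\<lambda>_. unif)) ?E
      \<le> ennreal ((1 - c) * c ^ (card I - 1) + c ^ card I / real (card I))"
    unfolding J(4) .
qed

text \<open>
  A sample whose range is shorter than \<open>c\<close> lies in the window event of the index of its least
  draw.
\<close>

lemma emeasure_uniform_range_less:
  fixes c :: real
  assumes I: "finite I" "I \<noteq> {}" and c: "0 < c" "c < 1"
  shows "{v \<in> space (PiM I (\<lambda>_. unif)). \<forall>i\<in>I. \<forall>j\<in>I. v i < v j + c} \<in> sets (PiM I (\<lambda>_. unif))"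
    (is "?S \<in> _")
    and "emeasure (PiM I (\<lambda>_. unif)) {v \<in> space (PiM I (\<lambda>_. unif)). \<forall>i\<in>I. \<forall>j\<in>I. v i < v j + c}
      \<le> ennreal (c ^ (card I - 1) * (c + real (card I) * (1 - c)))"
proof -
  let ?M = "PiM I (\<lambda>_. unif)"
  let ?E = "\<lambda>j. {v \<in> space ?M. \<forall>i\<in>I. v j \<le> v i \<and> v i < v j + c}"
  show "?S \<in> sets ?M"
    using I measurable_unif_coordinate
    by (intro sets.sets_Collect_finite_All' borel_measurable_less borel_measurable_add
        borel_measurable_const) auto
  have "?S \<subseteq> (\<Union>j\<in>I. ?E j)"
  proof
    fix v assume v: "v \<in> ?S"
    obtain j where "j \<in> I" "\<forall>i\<in>I. v j \<le> v i"
      using arg_min_if_finite[OF I, of v] by (meson not_le)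
    with v show "v \<in> (\<Union>j\<in>I. ?E j)"
      by auto
  qed
  then have "emeasure ?M ?S \<le> emeasure ?M (\<Union>j\<in>I. ?E j)"
    using emeasure_uniform_window(1)[OF I(1) _ c] I by (intro emeasure_mono sets.finite_UN) auto
  also have "\<dots> \<le> (\<Sum>j\<in>I. emeasure ?M (?E j))"
    using emeasure_uniform_window(1)[OF I(1) _ c] I by (intro emeasure_subadditive_finite) auto
  also have "\<dots> \<le> (\<Sum>j\<in>I. ennreal ((1 - c) * c ^ (card I - 1) + c ^ card I / real (card I)))"
    using emeasure_uniform_window(2)[OF I(1) _ c] by (rule sum_mono)
  also have "\<dots> = ennreal (real (card I) * ((1 - c) * c ^ (card I - 1) + c ^ card I / real (card I)))"
    using c by (simp add: ennreal_mult ennreal_of_nat_eq_real_of_nat)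
  also have "real (card I) * ((1 - c) * c ^ (card I - 1) + c ^ card I / real (card I))
      = c ^ (card I - 1) * (c + real (card I) * (1 - c))"
  proof -
    have "card I > 0"
      using I by (simp add: card_gt_0_iff)
    then show ?thesis
      by (cases "card I") (simp_all add: field_simps del: of_nat_Suc)
  qed
  finally show "emeasure ?M ?S \<le> ennreal (c ^ (card I - 1) * (c + real (card I) * (1 - c)))" .
qed

section \<open>Mass covered by the range of a sample from an arbitrary distribution\<close>

text \<open>
  For finite nonempty \<open>I\<close> this is \<open>{Min (x ` I)..Max (x ` I)}\<close>; without minimum and maximum
  its measurability in \<open>x\<close> is immediate.
\<close>

definition hull_of :: "'i set \<Rightarrow> ('i \<Rightarrow> real) \<Rightarrow> real set" where
  "hull_of I x = {y. (\<exists>i\<in>I. x i \<le> y) \<and> (\<exists>i\<in>I. y \<le> x i)}"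

lemma measurable_hull_mass:
  assumes "real_distribution D" "finite I"
  shows "(\<lambda>x. measure D (hull_of I x)) \<in> borel_measurable (PiM I (\<lambda>_. borel))"
proof -
  interpret D: real_distribution D by fact
  show ?thesis
  proof (rule D.measurable_measure)
    have "(\<lambda>p. fst p i) \<in> borel_measurable (PiM I (\<lambda>_. borel) \<Otimes>\<^sub>M D)" if "i \<in> I" for i
      by (rule measurable_compose[OF measurable_fst measurable_component_singleton[OF that]])
    moreover have "snd \<in> borel_measurable (PiM I (\<lambda>_. borel) \<Otimes>\<^sub>M D)"
      using measurable_snd[of "PiM I (\<lambda>_. borel)" D] by (simp cong: measurable_cong_sets)
    ultimately show "{p \<in> space (PiM I (\<lambda>_. borel) \<Otimes>\<^sub>M D). snd p \<in> hull_of I (fst p)}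
        \<in> sets (PiM I (\<lambda>_. borel) \<Otimes>\<^sub>M D)"
      using \<open>finite I\<close> unfolding hull_of_def mem_Collect_eq by measurable
  qed auto
qed

text \<open>
  If \<open>q\<close> is the quantile function of \<open>D\<close>, everything between the quantile levels \<open>a\<close> and \<open>b\<close> is mapped
  between \<open>q a\<close> and \<open>q b\<close>.  An atom of \<open>D\<close> can only add mass.
\<close>

lemma quantile_interval_mass:
  fixes q :: "real \<Rightarrow> real"
  assumes q: "q \<in> borel_measurable unif" "mono_on {0<..<1} q"
    and ab: "0 < a" "a \<le> b" "b < 1"
  shows "b - a \<le> measure (distr unif borel q) {q a..q b}"
proof -
  interpret unif: prob_space unif
    by (rule prob_space_unif)
  have "b - a = measure lborel {a..b}"
    using ab by simp
  also have "\<dots> = measure unif {a..b}"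
    using ab by (intro measure_restrict_space[symmetric]) auto
  also have "\<dots> \<le> measure unif (q -` {q a..q b} \<inter> space unif)"
    using ab q(1) by (intro unif.finite_measure_mono measurable_sets[OF q(1)])
      (auto simp: space_restrict_space intro!: mono_onD[OF q(2)])
  also have "\<dots> = measure (distr unif borel q) {q a..q b}"
    using q(1) by (intro measure_distr[symmetric]) auto
  finally show ?thesis .
qed

text \<open>
  Independent draws from \<open>D\<close> are the quantile function applied to independent uniform draws \<open>v\<close>.  If
  \<open>v i - v j \<ge> c\<close> for some \<open>i\<close> and \<open>j\<close>, the two corresponding draws from \<open>D\<close> alone enclose mass \<open>c\<close>.  So
  little mass can only be covered when the uniform range is short.
\<close>

lemma prob_hull_mass_less:
  assumes D: "real_distribution D" and I: "finite I" "I \<noteq> {}" and c: "0 < c" "c < 1"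
  shows "measure (PiM I (\<lambda>_. D)) {x \<in> space (PiM I (\<lambda>_. D)). measure D (hull_of I x) < c}
    \<le> c ^ (card I - 1) * (c + real (card I) * (1 - c))"
proof -
  interpret D: cdf_distribution D
    unfolding cdf_distribution_def by (rule D)
  interpret unif: prob_space unif
    by (rule prob_space_unif)
  let ?M = "PiM I (\<lambda>_. unif)" and ?B = "PiM I (\<lambda>_. borel :: real measure)" and ?q = D.I
  interpret M: prob_space ?M
    by (intro prob_space_PiM prob_space_unif)
  have q [measurable]: "?q \<in> borel_measurable unif"
    using D.measurable_CI by (simp cong: measurable_cong_sets)
  have D_eq: "distr unif borel ?q = D"
    by (rule D.distr_I_eq_M)
  have PiM_eq: "PiM I (\<lambda>_. D) = distr ?M ?B (compose I ?q)"
  proof -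
    have "distr ?M (PiM I (\<lambda>_. D)) (compose I ?q) = PiM I (\<lambda>_. distr unif D ?q)"
      using I prob_space_unif D.prob_space_axioms q
      by (intro distr_PiM_finite_prob_space') (auto cong: measurable_cong_sets)
    moreover have "distr ?M (PiM I (\<lambda>_. D)) (compose I ?q) = distr ?M ?B (compose I ?q)"
      by (intro distr_cong sets_PiM_cong) auto
    moreover have "distr unif D ?q = D"
      using D_eq by (metis D.events_eq_borel distr_cong)
    ultimately show ?thesis
      by simp
  qed
  let ?A = "{x \<in> space ?B. measure D (hull_of I x) < c}"
  have A: "?A \<in> sets ?B"
    using measurable_hull_mass[OF D I(1)] by measurable
  have comp: "compose I ?q \<in> measurable ?M ?B"
    unfolding compose_def by measurable
  let ?S = "{v \<in> space ?M. \<forall>i\<in>I. \<forall>j\<in>I. v i < v j + c}"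
  have "compose I ?q -` ?A \<inter> space ?M \<subseteq> ?S"
  proof (intro subsetI CollectI conjI ballI)
    fix v i j
    assume "v \<in> compose I ?q -` ?A \<inter> space ?M" and ij: "i \<in> I" "j \<in> I"
    then have v: "v \<in> space ?M" "measure D (hull_of I (compose I ?q v)) < c"
      by auto
    show "v i < v j + c"
    proof (rule ccontr)
      assume far: "\<not> v i < v j + c"
      have "0 < v j" "v i < 1"
        using v(1) ij by (auto simp: space_PiM space_restrict_space PiE_iff)
      then have "v i - v j \<le> measure D {?q (v j)..?q (v i)}"
        using quantile_interval_mass[OF q D.mono_I, of "v j" "v i"] c far unfolding D_eq by simp
      also have "\<dots> \<le> measure D (hull_of I (compose I ?q v))"
      proof (rule D.finite_measure_mono)
        show "{?q (v j)..?q (v i)} \<subseteq> hull_of I (compose I ?q v)"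
          using ij by (auto simp: hull_of_def compose_def)
        have "hull_of I (compose I ?q v)
            = (\<Union>i\<in>I. {compose I ?q v i..}) \<inter> (\<Union>i\<in>I. {..compose I ?q v i})"
          by (auto simp: hull_of_def)
        also have "\<dots> \<in> sets borel"
          using I by (intro sets.Int sets.finite_UN) auto
        finally show "hull_of I (compose I ?q v) \<in> sets D"
          by simp
      qed
      finally show False
        using v far by simp
    qed
  qed auto
  then have "emeasure ?M (compose I ?q -` ?A \<inter> space ?M) \<le> emeasure ?M ?S"
    using emeasure_uniform_range_less(1)[OF I c] by (rule emeasure_mono)
  also note emeasure_uniform_range_less(2)[OF I c]
  also have "emeasure ?M (compose I ?q -` ?A \<inter> space ?M) = ennreal (measure (distr ?M ?B (compose I ?q)) ?A)"
    by (simp add: measure_distr[OF comp A] M.emeasure_eq_measure)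
  finally have "measure (distr ?M ?B (compose I ?q)) ?A \<le> c ^ (card I - 1) * (c + real (card I) * (1 - c))"
    using c by (subst (asm) ennreal_le_iff) auto
  then show ?thesis
    by (simp add: PiM_eq)
qed

section \<open>The uncertainty set in dimension one\<close>

text \<open>
  The two possible directions \<open>1\<close> and \<open>-1\<close> exchange the roles of the greatest and the least
  projection, so the set does not depend on the choice.
\<close>

lemma vec_mem_U_PCA_iff:
  fixes x :: "nat \<Rightarrow> real" and U :: "real^1^1"
  assumes U: "orthogonal_matrix U" and N: "0 < N"
  shows "vec y \<in> U_PCA N (\<lambda>j. vec (x j)) U \<longleftrightarrow> y \<in> hull_of {1..N} x"
proof -
  define d where "d = U $ 1 $ 1"
  have col: "column 1 U = vec d"
    by (simp add: column_def d_def vec_eq_iff)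
  have "transpose U ** U = mat 1"
    using U by (simp add: orthogonal_matrix)
  then have "(transpose U ** U) $ 1 $ 1 = (mat 1 :: real^1^1) $ 1 $ 1"
    by simp
  then have "d * d = 1"
    by (simp add: matrix_matrix_mult_def transpose_def mat_def d_def)
  then have d: "d = 1 \<or> d = - 1"
    by (simp add: square_eq_1_iff)
  define m where "m = sample_mean N (\<lambda>j. vec (x j) :: real^1) $ 1"
  have mean: "sample_mean N (\<lambda>j. vec (x j)) = (vec m :: real^1)"
    by (simp add: m_def vec_eq_iff)
  have nd: "norm (vec d :: real^1) = 1"
    using d by (auto simp: norm_real)
  have proj: "(\<lambda>j. centred N (\<lambda>j. vec (x j)) j \<bullet> (vec d :: real^1) / norm (vec d :: real^1)) = (\<lambda>j. d * (x j - m))"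
    unfolding nd by (simp add: centred_def mean inner_vec_def fun_eq_iff)
  let ?P = "(\<lambda>j. d * (x j - m)) ` {1..N}"
  have P: "finite ?P" "?P \<noteq> {}"
    using N by auto
  have omega: "omega_max N (\<lambda>j. vec (x j)) (vec d :: real^1) = Max ?P"
    "omega_min N (\<lambda>j. vec (x j)) (vec d :: real^1) = Min ?P"
    unfolding omega_max_def omega_min_def proj by (rule refl)+
  have le: "Min ?P \<le> Max ?P"
    using P by (meson Max_in Min_le)
  have "vec y \<in> U_PCA N (\<lambda>j. vec (x j)) U
      \<longleftrightarrow> (\<exists>\<alpha>::1 \<Rightarrow> real. (\<forall>i. 0 \<le> \<alpha> i \<and> \<alpha> i \<le> 1)
            \<and> y = m + (\<alpha> 1 * Max ?P * d + (1 - \<alpha> 1) * Min ?P * d))"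
    by (simp add: U_PCA_def col nd omega mean vec_eq_iff conj_commute)
  also have "\<dots> \<longleftrightarrow> (\<exists>a. 0 \<le> a \<and> a \<le> 1 \<and> y = m + (a * Max ?P * d + (1 - a) * Min ?P * d))"
    by (rule iffI; elim exE) (blast, rule_tac x = "\<lambda>_. a" in exI, simp)
  also have "\<dots> \<longleftrightarrow> d * (y - m) \<in> closed_segment (Min ?P) (Max ?P)"
  proof -
    have "y = m + (a * M * d + (1 - a) * M' * d) \<longleftrightarrow> d * (y - m) = (1 - a) * M' + a * M" for a M M'
      using d by (auto simp: algebra_simps)
    then show ?thesis
      by (simp only: in_segment real_scaleR_def)
  qed
  also have "\<dots> \<longleftrightarrow> Min ?P \<le> d * (y - m) \<and> d * (y - m) \<le> Max ?P"
    using le by (simp add: closed_segment_eq_real_ivl)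
  also have "\<dots> \<longleftrightarrow> (\<exists>j\<in>{1..N}. d * (x j - m) \<le> d * (y - m)) \<and> (\<exists>j\<in>{1..N}. d * (y - m) \<le> d * (x j - m))"
    using P by (simp add: Min_le_iff Max_ge_iff)
  also have "\<dots> \<longleftrightarrow> y \<in> hull_of {1..N} x"
    unfolding hull_of_def using d by auto
  finally show ?thesis .
qed

section \<open>The confidence bound\<close>

theorem theorem3:
  fixes P :: "'p measure" and Q :: "'q measure"
    and X :: "nat \<Rightarrow> 'p \<Rightarrow> real" and s :: "'q \<Rightarrow> real"
    and U :: "'p \<Rightarrow> real^1^1" and evs :: "'p \<Rightarrow> real^1"
    and N :: nat and Nstar :: int and \<epsilon> \<beta> :: real
  assumes eps: "0 < \<epsilon>" "\<epsilon> < 1"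
    and beta: "0 < \<beta>" "\<beta> < 1"
    and Nstar: "Nstar = \<lceil>1 / \<epsilon> * (exp 1 / (exp 1 - 1)) * (1 + ln (1 / \<beta>))\<rceil>"
    and Q: "prob_space Q" "s \<in> borel_measurable Q"
    and P: "prob_space P"
    and indep: "prob_space.indep_vars P (\<lambda>_. borel) X {1..N}"
    and ident: "\<And>j. j \<in> {1..N} \<Longrightarrow> distr P borel (X j) = distr Q borel s"
    and decomp: "\<And>\<omega>. \<omega> \<in> space P \<Longrightarrow>
      eigen_decomposition (sample_cov N (\<lambda>j. vec (X j \<omega>))) (U \<omega>) (evs \<omega>)"
    and N: "real N \<ge>
      (ln \<beta> - ln (1 - \<epsilon> + real_of_int Nstar * \<epsilon>)) / ln (1 - \<epsilon>) + 1"
  shows "\<P>(\<omega> in P. \<P>(x in Q. vec (s x) \<in> U_PCA N (\<lambda>j. vec (X j \<omega>)) (U \<omega>)) \<ge> 1 - \<epsilon>)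
           \<ge> 1 - \<beta>"
proof -
  interpret P: prob_space P by fact
  interpret Q: prob_space Q by fact
  define I where "I = {1..N}"
  define D where "D = distr Q borel s"
  define c where "c = 1 - \<epsilon>"
  let ?B = "PiM I (\<lambda>_. borel :: real measure)" and ?X = "\<lambda>\<omega>. \<lambda>i\<in>I. X i \<omega>"
  note n = range_tail_le_of_sample_size[OF eps beta Nstar N]
  have I: "finite I" "I \<noteq> {}" "card I = N"
    using n(1) by (auto simp: I_def)
  have c: "0 < c" "c < 1"
    using eps by (simp_all add: c_def)
  have D: "real_distribution D"
    unfolding D_def using Q by simp
  have X: "X i \<in> borel_measurable P" if "i \<in> I" for i
    using indep that by (auto simp: P.indep_vars_def I_def)
  have X': "?X \<in> measurable P ?B"
    using X by (rule measurable_restrict)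
  have "distr P ?B ?X = PiM I (\<lambda>i. distr P borel (X i))"
    using P.indep_vars_iff_distr_eq_PiM'[of I X "\<lambda>_. borel"] indep I X by (simp add: I_def)
  also have "\<dots> = PiM I (\<lambda>_. D)"
    using ident by (intro PiM_cong) (auto simp: I_def D_def)
  finally have joint: "distr P ?B ?X = PiM I (\<lambda>_. D)" .
  have sets_D: "sets (PiM I (\<lambda>_. D)) = sets ?B"
    by (intro sets_PiM_cong) (auto simp: D_def)
  have hull: "hull_of I (?X \<omega>) = hull_of I (\<lambda>j. X j \<omega>)" for \<omega>
    by (auto simp: hull_of_def)
  have mass: "\<P>(x in Q. vec (s x) \<in> U_PCA N (\<lambda>j. vec (X j \<omega>)) (U \<omega>)) = measure D (hull_of I (?X \<omega>))"
    if "\<omega> \<in> space P" for \<omega>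
  proof -
    have U: "orthogonal_matrix (U \<omega>)"
      using decomp[OF that] by (simp add: eigen_decomposition_def)
    have "hull_of I (?X \<omega>) \<in> sets borel"
      using I(1) unfolding hull_of_def by measurable
    then have "measure D (hull_of I (?X \<omega>)) = measure Q (s -` hull_of I (?X \<omega>) \<inter> space Q)"
      unfolding D_def using Q by (intro measure_distr) auto
    also have "s -` hull_of I (?X \<omega>) \<inter> space Q = {x \<in> space Q. s x \<in> hull_of I (\<lambda>j. X j \<omega>)}"
      unfolding hull by auto
    also have "\<dots> = {x \<in> space Q. vec (s x) \<in> U_PCA N (\<lambda>j. vec (X j \<omega>)) (U \<omega>)}"
      unfolding I_def using vec_mem_U_PCA_iff[OF U n(1), of _ "\<lambda>j. X j \<omega>"] by simp
    finally show ?thesis ..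
  qed
  let ?A = "{x \<in> space ?B. measure D (hull_of I x) < c}"
  have A: "?A \<in> sets ?B"
    using measurable_hull_mass[OF D I(1)] by measurable
  let ?F = "?X -` ?A \<inter> space P"
  have F: "?F \<in> sets P"
    using X' A by (rule measurable_sets)
  have "measure P ?F = measure (distr P ?B ?X) ?A"
    using X' A by (simp add: measure_distr)
  also have "\<dots> \<le> c ^ (N - 1) * (c + real N * (1 - c))"
    using prob_hull_mass_less[OF D I(1,2) c] unfolding joint I(3) sets_eq_imp_space_eq[OF sets_D] .
  also have "\<dots> \<le> \<beta>"
    using n(2) by (simp add: c_def)
  finally have "1 - \<beta> \<le> measure P (space P - ?F)"
    using F by (simp add: P.prob_compl)
  also have "space P - ?F
      = {\<omega> \<in> space P. \<P>(x in Q. vec (s x) \<in> U_PCA N (\<lambda>j. vec (X j \<omega>)) (U \<omega>)) \<ge> 1 - \<epsilon>}"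
    using measurable_space[OF X'] by (auto simp: mass c_def not_less)
  finally show ?thesis .
qed

end
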